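(* Let $I=(0,1)$ or $I=(0,\infty)$, and let $E,F$ be Banach ideal spaces on $I$ such that $F$ has the Fatou property, $E^{( * )}\ne\{0\}$ and $F^{( * )}\neq\{0\}$ are normable spaces, the operator $D_2$ is bounded on $F^{\downarrow}$, $(F')^{( * )}\neq\{0\}$ and $((E\odot F')')^{( * )}\neq\{0\}$. Assume that: (i) the operator $H^*$ is bounded on the spaces $F$ and $E\odot F'$; (ii) for some $r>0$, the operator $H_r^*$ is bounded on $E$ and on $F'$, and there are constants $C_E,C_{F'}$ such that $\|H_rx^*\|_E\le C_E\|x^*\|_E$ for all $x^*\in E$ and $\|H_rx^*\|_{F'}\le C_{F'}\|x^*\|_{F'}$ for all $x^*\in F'$; (iii) $M(E,F)^{( * )}\neq\{0\}$, the operator $D_2$ is bounded both on $E^{\downarrow}$ and on $M(E,F)^{\downarrow}$, and for some $r_1>0$ the operator $H_{r_1}^*$ is bounded on the spaces $E$ and $M(E,F)$. If $F$ factorizes through $E$, i.e., $F=E\odot M(E,F)$, then the symmetrization $F^{( * )}$ factorizes through the symmetrization $E^{( * )}$, that is, $$F^{( * )}=E^{( * )}\odot M(E^{( * )},F^{( * )}).$$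
   Context: Equalities of spaces mean equality as sets with equivalent (quasi-)norms. $I=(0,1)$ or $(0,\infty)$ with Lebesgue measure $m$; $L^0(I)$ is the space of (classes of) real measurable functions on $I$. A (quasi-)normed ideal space $E$ on $I$ is a linear subspace of $L^0(I)$ with a (quasi-)norm such that $y\in E$, $x\in L^0$, $|x|\le|y|$ a.e. imply $x\in E$ and $\|x\|_E\le\|y\|_E$; a Banach ideal space is a complete normed one. Such spaces are always assumed to have a weak unit (an element positive a.e. on $I$). $E$ has the Fatou property if $0\le x_n\uparrow x\in L^0$, $x_n\in E$, $\sup_n\|x_n\|_E<\infty$ imply $x\in E$ and $\|x_n\|_E\uparrow\|x\|_E$. A quasi-normed space is normable if it carries a norm equivalent to its quasi-norm. $x^*(t)=\inf\{\lambda>0: m\{|x|>\lambda\}\le t\}$ is the nonincreasing rearrangement. The symmetrization of $E$ is $E^{( * )}=\{x\in L^0(I):x^*\in E\}$ with functional $\|x\|_{E^{( * )}}=\|x^*\|_E$. $E^{\downarrow}$ is the cone of all $x\in E$ with $x=x^*$. "For all $x^*\in E$" means for all $x\in L^0(I)$ with $x^*\in E$. Dilation operator: $D_2x(t)=x(t/2)$, $t\in I$; bounded on $X^{\downarrow}$ means $\|D_2x\|_X\le A\|x\|_X$ for all $x\in X^{\downarrow}$ and some $A<\infty$. Köthe dual: $E'=\{x\in L^0(I):\|x\|_{E'}=\sup_{\|y\|_E\le1}\int_I|xy|\,dt<\infty\}$. Product space: $E\odot F=\{xy:x\in E,y\in F\}$ with quasi-norm $\|u\|_{E\odot F}=\inf\{\|x\|_E\|y\|_F:u=xy,\,x\in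 E,\,y\in F\}$. Multipliers: $M(E,F)=\{x\in L^0(I):xy\in F\text{ for each }y\in E\}$ with $\|x\|_{M(E,F)}=\sup_{\|y\|_E=1}\|xy\|_F$. With $l=m(I)$: $Hx(t)=\frac1t\int_0^tx(s)\,ds$, $H^*x(t)=\int_t^l\frac{x(s)}s\,ds$, and for $r>0$, $H_rx=[H(|x|^r)]^{1/r}$, $H_r^*x=[H^*(|x|^r)]^{1/r}$. An operator $T$ among these is bounded on a space $X$ if $Tx\in X$ and $\|Tx\|_X\le C\|x\|_X$ for all $x\in X$ and some constant $C$. *)

theory Defs
  imports "HOL-Analysis.Analysis"
begin

text \<open>
  Elements of $L^0(I)$ are represented by functions on the reals that are Lebesgue measurable
  on \<open>I\<close>; two functions that agree almost everywhere on \<open>I\<close> represent the same element, and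
  the values off \<open>I\<close> are irrelevant.
\<close>

definition L0 :: "real set \<Rightarrow> (real \<Rightarrow> real) set" where
  "L0 I = borel_measurable (lebesgue_on I)"

text \<open>
  A space is a carrier together with a functional. The functional takes values in \<open>ennreal\<close>, so
  that the suprema and infima below need no side conditions; its values off the carrier carry no
  meaning.
\<close>

record fspace =
  car :: "(real \<Rightarrow> real) set"
  nrm :: "(real \<Rightarrow> real) \<Rightarrow> ennreal"

definition quasi_normed_const :: "real set \<Rightarrow> real \<Rightarrow> fspace \<Rightarrow> bool" where
  "quasi_normed_const I K X \<longleftrightarrow>
     car X \<subseteq> L0 I \<and>
     (\<lambda>t. 0) \<in> car X \<and>
     (\<forall>x\<in>car X. \<forall>y\<in>car X. (\<lambda>t. x t + y t) \<in> car X) \<and>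
     (\<forall>c. \<forall>x\<in>car X. (\<lambda>t. c * x t) \<in> car X) \<and>
     (\<forall>x\<in>car X. nrm X x < \<infinity>) \<and>
     (\<forall>x\<in>car X. nrm X x = 0 \<longleftrightarrow> (AE t in lebesgue_on I. x t = 0)) \<and>
     (\<forall>c. \<forall>x\<in>car X. nrm X (\<lambda>t. c * x t) = ennreal \<bar>c\<bar> * nrm X x) \<and>
     (\<forall>x\<in>car X. \<forall>y\<in>car X. nrm X (\<lambda>t. x t + y t) \<le> ennreal K * (nrm X x + nrm X y))"

definition quasi_normed :: "real set \<Rightarrow> fspace \<Rightarrow> bool" where
  "quasi_normed I X \<longleftrightarrow> (\<exists>K\<ge>1. quasi_normed_const I K X)"

definition normed :: "real set \<Rightarrow> fspace \<Rightarrow> bool" where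
  "normed I X \<longleftrightarrow> quasi_normed_const I 1 X"

text \<open>
  The ideal property below also makes the carrier and the functional invariant under changes on
  null sets.
\<close>

definition ideal_property :: "real set \<Rightarrow> fspace \<Rightarrow> bool" where
  "ideal_property I X \<longleftrightarrow>
     (\<forall>y\<in>car X. \<forall>x\<in>L0 I. (AE t in lebesgue_on I. \<bar>x t\<bar> \<le> \<bar>y t\<bar>) \<longrightarrow>
        x \<in> car X \<and> nrm X x \<le> nrm X y)"

definition has_weak_unit :: "real set \<Rightarrow> fspace \<Rightarrow> bool" where
  "has_weak_unit I X \<longleftrightarrow> (\<exists>x\<in>car X. AE t in lebesgue_on I. x t > 0)"

definition complete_space :: "fspace \<Rightarrow> bool" where
  "complete_space X \<longleftrightarrow>
     (\<forall>s :: nat \<Rightarrow> real \<Rightarrow> real.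
        (\<forall>n. s n \<in> car X) \<and>
        (\<forall>e>0. \<exists>N. \<forall>m\<ge>N. \<forall>n\<ge>N. nrm X (\<lambda>t. s m t - s n t) < ennreal e) \<longrightarrow>
        (\<exists>x\<in>car X. (\<lambda>n. nrm X (\<lambda>t. s n t - x t)) \<longlonglongrightarrow> 0))"

definition banach_ideal_space :: "real set \<Rightarrow> fspace \<Rightarrow> bool" where
  "banach_ideal_space I X \<longleftrightarrow>
     normed I X \<and> ideal_property I X \<and> has_weak_unit I X \<and> complete_space X"

definition fatou_property :: "real set \<Rightarrow> fspace \<Rightarrow> bool" where
  "fatou_property I X \<longleftrightarrow>
     (\<forall>s :: nat \<Rightarrow> real \<Rightarrow> real. \<forall>x\<in>L0 I.
        (\<forall>n. s n \<in> car X) \<and>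
        (AE t in lebesgue_on I. 0 \<le> s 0 t \<and> incseq (\<lambda>n. s n t) \<and> (\<lambda>n. s n t) \<longlonglongrightarrow> x t) \<and>
        (SUP n. nrm X (s n)) < \<infinity> \<longrightarrow>
        x \<in> car X \<and> incseq (\<lambda>n. nrm X (s n)) \<and> (\<lambda>n. nrm X (s n)) \<longlonglongrightarrow> nrm X x)"

definition nonzero_space :: "real set \<Rightarrow> fspace \<Rightarrow> bool" where
  "nonzero_space I X \<longleftrightarrow> (\<exists>x\<in>car X. \<not> (AE t in lebesgue_on I. x t = 0))"

definition same_space :: "fspace \<Rightarrow> fspace \<Rightarrow> bool" where
  "same_space X Y \<longleftrightarrow>
     car X = car Y \<and>
     (\<exists>C::real. \<forall>x\<in>car X. nrm X x \<le> ennreal C * nrm Y x \<and> nrm Y x \<le> ennreal C * nrm X x)"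

definition normable :: "real set \<Rightarrow> fspace \<Rightarrow> bool" where
  "normable I X \<longleftrightarrow> quasi_normed I X \<and> (\<exists>Y. normed I Y \<and> same_space X Y)"

text \<open>
  The rearrangement of \<open>x\<close> may be infinite when \<open>I\<close> is unbounded. The predicate
  \<open>rearrangeable\<close> says that it is finite throughout \<open>I\<close>; only then is the real infimum in
  \<open>rearr\<close> meaningful, and only then can the rearrangement belong to a space of real functions.
\<close>

definition level_set :: "real set \<Rightarrow> (real \<Rightarrow> real) \<Rightarrow> real \<Rightarrow> real set" where
  "level_set I x t = {l. l > 0 \<and> emeasure (lebesgue_on I) {s\<in>I. \<bar>x s\<bar> > l} \<le> ennreal t}"

definition rearrangeable :: "real set \<Rightarrow> (real \<Rightarrow> real) \<Rightarrow> bool" where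
  "rearrangeable I x \<longleftrightarrow> (\<forall>t\<in>I. level_set I x t \<noteq> {})"

definition rearr :: "real set \<Rightarrow> (real \<Rightarrow> real) \<Rightarrow> real \<Rightarrow> real" where
  "rearr I x t = Inf (level_set I x t)"

definition symmetrization :: "real set \<Rightarrow> fspace \<Rightarrow> fspace" where
  "symmetrization I X =
     \<lparr> car = {x \<in> L0 I. rearrangeable I x \<and> rearr I x \<in> car X},
       nrm = (\<lambda>x. nrm X (rearr I x)) \<rparr>"

definition decreasing_cone :: "real set \<Rightarrow> fspace \<Rightarrow> (real \<Rightarrow> real) set" where
  "decreasing_cone I X =
     {x \<in> car X. rearrangeable I x \<and> (AE t in lebesgue_on I. x t = rearr I x t)}"

definition koethe_dual :: "real set \<Rightarrow> fspace \<Rightarrow> fspace" where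
  "koethe_dual I X =
     (let N = (\<lambda>x. SUP y\<in>{y \<in> car X. nrm X y \<le> 1}. \<integral>\<^sup>+t. ennreal \<bar>x t * y t\<bar> \<partial>lebesgue_on I)
      in \<lparr> car = {x \<in> L0 I. N x < \<infinity>}, nrm = N \<rparr>)"

definition product_space :: "real set \<Rightarrow> fspace \<Rightarrow> fspace \<Rightarrow> fspace" where
  "product_space I X Y =
     (let P = (\<lambda>u. {(x, y). x \<in> car X \<and> y \<in> car Y \<and> (AE t in lebesgue_on I. u t = x t * y t)})
      in \<lparr> car = {u \<in> L0 I. P u \<noteq> {}},
           nrm = (\<lambda>u. INF (x, y)\<in>P u. nrm X x * nrm Y y) \<rparr>)"

definition multipliers :: "real set \<Rightarrow> fspace \<Rightarrow> fspace \<Rightarrow> fspace" where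
  "multipliers I X Y =
     \<lparr> car = {x \<in> L0 I. \<forall>y\<in>car X. (\<lambda>t. x t * y t) \<in> car Y},
       nrm = (\<lambda>x. SUP y\<in>{y \<in> car X. nrm X y = 1}. nrm Y (\<lambda>t. x t * y t)) \<rparr>"

text \<open>
  Operators are partial: the result is \<open>None\<close> if one of the defining integrals, over
  $(0,t)$ or $(t,m(I))$ with \<open>t \<in> I\<close>, does not exist as a finite Lebesgue integral (the library
  integral would silently be 0 there).
\<close>

type_synonym operator = "(real \<Rightarrow> real) \<Rightarrow> (real \<Rightarrow> real) option"

definition hardy :: "real set \<Rightarrow> operator" where
  "hardy I x =
     (if \<forall>t\<in>I. set_integrable lebesgue {0<..<t} x
      then Some (\<lambda>t. (1 / t) * (LINT s:{0<..<t}|lebesgue. x s)) else None)"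

definition hardy_adj :: "real set \<Rightarrow> operator" where
  "hardy_adj I x =
     (if \<forall>t\<in>I. set_integrable lebesgue (I \<inter> {t<..}) (\<lambda>s. x s / s)
      then Some (\<lambda>t. LINT s:(I \<inter> {t<..})|lebesgue. x s / s) else None)"

definition power_op :: "real \<Rightarrow> operator \<Rightarrow> operator" where
  "power_op r T x = map_option (\<lambda>y t. y t powr (1 / r)) (T (\<lambda>s. \<bar>x s\<bar> powr r))"

definition dilation2 :: operator where
  "dilation2 x = Some (\<lambda>t. x (t / 2))"

definition bounded_on :: "(real \<Rightarrow> real) set \<Rightarrow> fspace \<Rightarrow> operator \<Rightarrow> bool" where
  "bounded_on S X T \<longleftrightarrow>
     (\<exists>C::real. \<forall>x\<in>S. \<exists>y. T x = Some y \<and> y \<in> car X \<and> nrm X y \<le> ennreal C * nrm X x)"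

end

theory Submission
  imports Defs
begin

text \<open>
  Given $u \in F^{(*)}$, write $u^* = xy$ with $x \in E$, $y \in M(E,F)$. The functions
  $h = H^*_{r_1} x$ and $k = H^*_{r_1} y$ are nonincreasing and stay in $E$ and $M(E,F)$. If
  $u^* \ge \lambda$ on $(0,T)$, averaging $|x|^{r_1/2} |y|^{r_1/2} \ge \lambda^{r_1/2}$ over
  $(T/2,T)$ gives $\lambda \le 4^{1/r_1} h(T/2) k(T/2)$. With
  $T(\lambda) = \sup \{t : u^*(t) \ge \lambda\}$, which is finite because $H^*$ acts on $F$, put
  $a = 4^{1/r_1} h(T(|u|)/2)$ and $b = u/a$. Then $a^* \le 4^{1/r_1} D_2 h$ and $b^* \le D_2 k$,
  so $a \in E^{(*)}$, and $b$ multiplies $E^{(*)}$ into $F^{(*)}$ since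
  $(bz)^* \le D_2 (D_2 k \cdot z^*)$.
\<close>

text \<open>The factors x and y need not be monotone, and \<open>E\<close> need not contain the
  rearrangement of x, so they cannot be transported to u directly. The adjoint Hardy operator of
  order r1 trades them for nonincreasing functions, for which pointwise bounds translate into
  distribution estimates. That the product h k still controls u^* is a Cauchy-Schwarz argument,
  which explains the exponent r1/2: the squares of the two averaged factors, divided by s, are the
  integrands of the two operators. The 4 is the inverse square of 1/2, a lower bound for the
  integral of ds/s over (T/2, T). The factor a is a function of |u|, so its superlevel sets compare
  with those of u: if |u(s)| is at most u^*(t), then T(|u(s)|) is at least t. The opposite inclusion
  follows from the definition of multipliers and homogeneity. Since the product quasi-norm is an
  infimum over factorizations, one constant has to serve all u, x and y at once.\<close>

text \<open>Multiplication by the finite positive \<open>D\<close> is undone by 1/D, so a bound for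
  every factorization passes to the infimum in the product quasi-norm.\<close>

lemma le_mult_INF_ennreal:
  fixes f :: "'a \<Rightarrow> ennreal"
  assumes "0 < D" "\<And>x. x \<in> S \<Longrightarrow> m \<le> ennreal D * f x"
  shows "m \<le> ennreal D * (INF x\<in>S. f x)"
proof -
  have inv: "ennreal (1 / D) * ennreal D = 1" using assms(1) by (simp flip: ennreal_mult)
  have "ennreal (1 / D) * m \<le> f x" if "x \<in> S" for x
  proof -
    have "ennreal (1 / D) * m \<le> ennreal (1 / D) * (ennreal D * f x)"
      by (intro mult_left_mono assms(2) that) simp
    then show ?thesis by (simp only: mult.assoc[symmetric] inv mult_1)
  qed
  then have "ennreal (1 / D) * m \<le> (INF x\<in>S. f x)" by (rule INF_greatest)
  then have "ennreal D * (ennreal (1 / D) * m) \<le> ennreal D * (INF x\<in>S. f x)"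
    by (rule mult_left_mono) simp
  then show ?thesis
    using inv by (simp only: mult.assoc[symmetric] mult.commute[of "ennreal D"] mult_1)
qed

text \<open>The choice c = \<mu>/(2A) makes the first term \<mu>/2 and avoids the square root in the
  optimal c. If A = 0, a large c contradicts \<mu> > 0.\<close>

lemma le_four_mult_if_AM_GM:
  fixes A B \<mu> :: real
  assumes "0 \<le> A" "0 < \<mu>" "\<And>c. 0 < c \<Longrightarrow> \<mu> \<le> c * A + B / c"
  shows "\<mu>\<^sup>2 \<le> 4 * (A * B)"
proof (cases "A = 0")
  case False
  then have "\<mu> \<le> \<mu> / (2 * A) * A + B / (\<mu> / (2 * A))"
    using assms by (intro assms(3)) auto
  also have "\<dots> = \<mu> / 2 + 2 * (A * B) / \<mu>" using False by (simp add: field_simps)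
  finally have "\<mu> / 2 * \<mu> \<le> 2 * (A * B) / \<mu> * \<mu>"
    using assms(2) by (intro mult_right_mono) auto
  then show ?thesis using assms(2) by (simp add: power2_eq_square)
next
  case True
  \<comment> \<open>This c is chosen so that \<mu> c = |B| + \<mu>, which exceeds B.\<close>
  have "0 < \<bar>B\<bar> / \<mu> + 1" using assms(2) by (simp add: add_nonneg_pos)
  from assms(3)[OF this] this have "\<mu> * (\<bar>B\<bar> / \<mu> + 1) \<le> B"
    using True by (simp add: field_simps)
  then have "\<bar>B\<bar> + \<mu> \<le> B" using assms(2) by (simp add: distrib_left)
  with assms(2) have False by linarith
  then show ?thesis ..
qed

section \<open>Level sets and rearrangements on \<open>I\<close>\<close>

locale interval_from_zero =
  fixes I :: "real set"
  assumes interval: "I = {0<..<1} \<or> I = {0<..}"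
begin

lemma sets_I [simp, measurable]: "I \<in> sets lebesgue"
  using interval by auto

lemma pos: "t \<in> I \<Longrightarrow> 0 < t"
  using interval by auto

lemma Ioc_subset: "t \<in> I \<Longrightarrow> {0<..t} \<subseteq> I"
  using interval by auto

lemma half_mem: "t \<in> I \<Longrightarrow> t / 2 \<in> I"
  using interval by auto

lemma ex_greater: "t \<in> I \<Longrightarrow> \<exists>t'\<in>I. t < t'"
  using interval dense[of t 1] gt_ex[of t] by force

lemma emeasure_Ioc: "t \<in> I \<Longrightarrow> emeasure (lebesgue_on I) {0<..t} = ennreal t"
  using pos[of t] Ioc_subset[of t] by (simp add: emeasure_restrict_space)

lemma superlevel_sets [measurable]:
  "x \<in> L0 I \<Longrightarrow> {s \<in> I. \<bar>x s\<bar> > l} \<in> sets (lebesgue_on I)"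
proof -
  assume "x \<in> L0 I"
  then have [measurable]: "x \<in> borel_measurable (lebesgue_on I)" by (simp add: L0_def)
  have "{s \<in> space (lebesgue_on I). \<bar>x s\<bar> > l} \<in> sets (lebesgue_on I)" by measurable
  then show ?thesis by simp
qed

lemma level_set_upward:
  assumes "x \<in> L0 I" "l \<in> level_set I x t" "l \<le> l'"
  shows "l' \<in> level_set I x t"
proof -
  have "emeasure (lebesgue_on I) {s \<in> I. \<bar>x s\<bar> > l'} \<le> emeasure (lebesgue_on I) {s \<in> I. \<bar>x s\<bar> > l}"
    using assms by (intro emeasure_mono superlevel_sets) auto
  with assms(2,3) show ?thesis by (auto simp: level_set_def)
qed

lemma level_set_bdd_below: "bdd_below (level_set I x t)"
  by (rule bdd_belowI[of _ 0]) (simp add: level_set_def)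

text \<open>All members of \<open>level_set\<close> are positive, so c = 0 is never one of them;
  every c + e with e > 0 is, and e tends to 0. Through this lemma distribution estimates become
  pointwise bounds on rearrangements.\<close>

lemma
  assumes "x \<in> L0 I" "0 \<le> c" "emeasure (lebesgue_on I) {s \<in> I. \<bar>x s\<bar> > c} \<le> ennreal t"
  shows level_set_nonempty: "level_set I x t \<noteq> {}"
    and rearr_le: "rearr I x t \<le> c"
proof -
  have *: "c + e \<in> level_set I x t" if "0 < e" for e
  proof -
    have "emeasure (lebesgue_on I) {s \<in> I. \<bar>x s\<bar> > c + e}
        \<le> emeasure (lebesgue_on I) {s \<in> I. \<bar>x s\<bar> > c}"
      using assms that by (intro emeasure_mono superlevel_sets) auto
    with assms that show ?thesis by (auto simp: level_set_def)
  qed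
  from *[of 1] show "level_set I x t \<noteq> {}" by auto
  show "rearr I x t \<le> c" unfolding rearr_def
    by (rule field_le_epsilon) (rule cInf_lower[OF * level_set_bdd_below])
qed

lemma rearr_nonneg: "level_set I x t \<noteq> {} \<Longrightarrow> 0 \<le> rearr I x t"
  unfolding rearr_def by (rule cInf_greatest) (auto simp: level_set_def)

text \<open>Right continuity of the distribution function: the superlevel set is the increasing
  union of those at heights \<open>rearr I x t + 1 / Suc n\<close>, each of which belongs to
  \<open>level_set\<close>.\<close>

lemma emeasure_superlevel_rearr:
  assumes "x \<in> L0 I" "level_set I x t \<noteq> {}"
  shows "emeasure (lebesgue_on I) {s \<in> I. \<bar>x s\<bar> > rearr I x t} \<le> ennreal t"
proof -
  define A where "A n = {s \<in> I. \<bar>x s\<bar> > rearr I x t + 1 / Suc n}" for n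
  have A: "emeasure (lebesgue_on I) (A n) \<le> ennreal t" for n
  proof -
    have "Inf (level_set I x t) < rearr I x t + 1 / Suc n"
      unfolding rearr_def by simp
    then obtain l where l: "l \<in> level_set I x t" "l < rearr I x t + 1 / Suc n"
      using cInf_lessD[OF assms(2)] by blast
    have "rearr I x t + 1 / Suc n \<in> level_set I x t"
      by (rule level_set_upward[OF assms(1) l(1) less_imp_le[OF l(2)]])
    then show ?thesis by (simp add: level_set_def A_def)
  qed
  have "incseq A"
    unfolding incseq_def A_def
  proof (intro allI impI subsetI CollectI conjI; clarsimp)
    fix m n s assume "m \<le> (n::nat)" "rearr I x t + 1 / (1 + real m) < \<bar>x s\<bar>"
    moreover from \<open>m \<le> n\<close> have "1 / (1 + real n) \<le> 1 / (1 + real m)"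
      by (intro divide_left_mono) auto
    ultimately show "rearr I x t + 1 / (1 + real n) < \<bar>x s\<bar>" by linarith
  qed
  moreover have "range A \<subseteq> sets (lebesgue_on I)"
    unfolding A_def using superlevel_sets[OF assms(1)] by blast
  moreover have "{s \<in> I. \<bar>x s\<bar> > rearr I x t} = (\<Union>n. A n)"
  proof (intro equalityI subsetI)
    fix s assume s: "s \<in> {s \<in> I. \<bar>x s\<bar> > rearr I x t}"
    then obtain n where "1 / Suc n < \<bar>x s\<bar> - rearr I x t"
      using nat_approx_posE[of "\<bar>x s\<bar> - rearr I x t"] by auto
    with s show "s \<in> (\<Union>n. A n)" by (auto simp: A_def intro!: exI[of _ n])
  next
    fix s assume "s \<in> (\<Union>n. A n)"
    then obtain n where "s \<in> I" "rearr I x t + 1 / Suc n < \<bar>x s\<bar>" by (auto simp: A_def)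
    moreover have "0 < 1 / real (Suc n)" by simp
    ultimately have "rearr I x t < \<bar>x s\<bar>" by linarith
    with \<open>s \<in> I\<close> show "s \<in> {s \<in> I. \<bar>x s\<bar> > rearr I x t}" by simp
  qed
  ultimately have "emeasure (lebesgue_on I) {s \<in> I. \<bar>x s\<bar> > rearr I x t}
      = (SUP n. emeasure (lebesgue_on I) (A n))"
    by (simp add: SUP_emeasure_incseq)
  with A show ?thesis by (simp add: SUP_least)
qed

lemma antimono_on_rearr:
  assumes "x \<in> L0 I" "rearrangeable I x"
  shows "antimono_on I (rearr I x)"
proof (rule monotone_onI)
  fix s t assume "s \<in> I" "t \<in> I" "s \<le> t"
  with assms have "emeasure (lebesgue_on I) {w \<in> I. \<bar>x w\<bar> > rearr I x s} \<le> ennreal t"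
    by (intro order_trans[OF emeasure_superlevel_rearr] ennreal_leI) (auto simp: rearrangeable_def)
  with assms \<open>s \<in> I\<close> show "rearr I x t \<le> rearr I x s"
    by (intro rearr_le rearr_nonneg) (auto simp: rearrangeable_def)
qed

lemma antimono_on_L0:
  assumes "antimono_on I h"
  shows "h \<in> L0 I"
proof -
  have "mono_on I (\<lambda>t. - h t)" using assms by (auto simp: monotone_on_def)
  then have "(\<lambda>t. - h t) \<in> borel_measurable (restrict_space borel I)"
    by (rule borel_measurable_mono_on_fnc)
  then have "(\<lambda>t. - (- h t)) \<in> borel_measurable (restrict_space borel I)"
    by (rule borel_measurable_uminus)
  then have "h \<in> borel_measurable (restrict_space borel I)" by (simp only: minus_minus)
  moreover have "sets (restrict_space borel I) \<subseteq> sets (lebesgue_on I)"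
    unfolding sets_restrict_space by (intro image_mono subsetI) (simp add: sets_completionI_sets)
  ultimately show ?thesis
    unfolding L0_def by (auto simp: measurable_def space_restrict_space)
qed

text \<open>The set where h exceeds h(t) lies in (0,t], so the rearrangement is at most h; equality
  holds wherever h is continuous, hence off a countable set. This places nonincreasing functions in
  \<open>decreasing_cone\<close>, where the dilation hypotheses apply.\<close>

lemma
  assumes h: "antimono_on I h" and nonneg: "\<And>t. t \<in> I \<Longrightarrow> 0 \<le> h t"
  shows antimono_on_rearrangeable: "rearrangeable I h"
    and AE_rearr_eq: "AE t in lebesgue_on I. h t = rearr I h t"
proof -
  note L0 = antimono_on_L0[OF h]
  have le: "emeasure (lebesgue_on I) {s \<in> I. \<bar>h s\<bar> > h t} \<le> ennreal t" if "t \<in> I" for t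
  proof -
    have "{s \<in> I. \<bar>h s\<bar> > h t} \<subseteq> {0<..t}"
    proof
      fix s assume "s \<in> {s \<in> I. \<bar>h s\<bar> > h t}"
      then have s: "s \<in> I" "h s > h t" using nonneg by auto
      then have "s \<le> t" using monotone_onD[OF h \<open>t \<in> I\<close> \<open>s \<in> I\<close>] by force
      with s pos show "s \<in> {0<..t}" by auto
    qed
    moreover have "{0<..t} \<in> sets (lebesgue_on I)"
      using Ioc_subset[OF that] by (simp add: sets_restrict_space_iff)
    ultimately show ?thesis
      using emeasure_mono[of "{s \<in> I. \<bar>h s\<bar> > h t}" "{0<..t}" "lebesgue_on I"]
      by (simp add: emeasure_Ioc that)
  qed
  then show re: "rearrangeable I h"
    unfolding rearrangeable_def using level_set_nonempty[OF L0 nonneg le] by blast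
  have eq: "h t = rearr I h t" if t: "t \<in> I" "isCont h t" for t
  proof (rule antisym)
    show "rearr I h t \<le> h t" using rearr_le[OF L0 nonneg le] t by blast
    show "h t \<le> rearr I h t"
    proof (rule ccontr)
      \<comment> \<open>A strict inequality at t would persist at some t2 > t by continuity from the
        right. By monotonicity h then exceeds \<open>rearr I h t\<close> on all of (0,t2], a set of
        measure larger than t.\<close>
      assume less: "\<not> h t \<le> rearr I h t"
      have "(h \<longlongrightarrow> h t) (at_right t)"
        using continuous_at_imp_continuous_at_within[OF t(2)] by (simp only: continuous_within)
      then have "eventually (\<lambda>s. h s > rearr I h t) (at_right t)"
        by (rule order_tendstoD(1)) (use less in linarith)
      moreover obtain t1 where "t1 \<in> I" "t < t1" using ex_greater t by blast
      ultimately have "eventually (\<lambda>s. h s > rearr I h t \<and> s \<in> {t<..<t1}) (at_right t)"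
        by (intro eventually_conj eventually_at_right_real)
      then obtain t2 where t2: "t < t2" "t2 < t1" "h t2 > rearr I h t"
        using eventually_happens'[OF trivial_limit_at_right_real] by fastforce
      have t2I: "t2 \<in> I" using Ioc_subset[OF \<open>t1 \<in> I\<close>] t2 pos[OF t(1)] by auto
      have "{0<..t2} \<subseteq> {s \<in> I. \<bar>h s\<bar> > rearr I h t}"
      proof
        fix s assume s: "s \<in> {0<..t2}"
        then have "s \<in> I" using Ioc_subset[OF t2I] by auto
        then have "h s \<ge> h t2" using monotone_onD[OF h _ t2I] s by auto
        with t2 \<open>s \<in> I\<close> show "s \<in> {s \<in> I. \<bar>h s\<bar> > rearr I h t}" by auto
      qed
      then have "ennreal t2 \<le> emeasure (lebesgue_on I) {s \<in> I. \<bar>h s\<bar> > rearr I h t}"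
        using emeasure_mono[OF _ superlevel_sets[OF L0], of "{0<..t2}"] emeasure_Ioc[OF t2I]
        by (simp only:)
      also have "\<dots> \<le> ennreal t"
        using emeasure_superlevel_rearr[OF L0] re t(1) unfolding rearrangeable_def by blast
      finally have "t2 \<le> t" using pos[OF t(1)] by (simp add: ennreal_le_iff)
      with t2(1) show False by simp
    qed
  qed
  have "mono_on I (\<lambda>t. - h t)" using h by (auto simp: monotone_on_def)
  moreover have "open I" using interval by auto
  ultimately have "countable {t \<in> I. \<not> isCont (\<lambda>t. - h t) t}"
    by (simp add: mono_on_ctble_discont_open)
  moreover have "isCont h t" if "isCont (\<lambda>t. - h t) t" for t
    using continuous_minus[OF that] by simp
  ultimately have "countable {t \<in> I. \<not> isCont h t}"
    by (elim countable_subset[rotated]) auto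
  then have "AE t in lebesgue. t \<notin> {t \<in> I. \<not> isCont h t}"
    by (intro AE_not_in) (simp add: countable_imp_null_set_lborel null_sets_completionI)
  then have "AE t in lebesgue. t \<in> I \<longrightarrow> h t = rearr I h t"
    by (rule AE_mp) (intro AE_I2, use eq in blast)
  then show "AE t in lebesgue_on I. h t = rearr I h t"
    by (subst AE_restrict_space_iff) simp_all
qed

section \<open>Membership in symmetrizations and dilation of nonincreasing functions\<close>

text \<open>The distribution estimate says that the rearrangement of \<open>a\<close> is at most
  \<open>f\<close> on \<open>I\<close>; the ideal property does the rest. Both factors of u and the
  products with multipliers are handled in this form.\<close>

lemma symmetrization_dominated:
  assumes "ideal_property I X" "f \<in> car X" "a \<in> L0 I"
    and nonneg: "\<And>t. t \<in> I \<Longrightarrow> 0 \<le> f t"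
    and dom: "\<And>t. t \<in> I \<Longrightarrow> emeasure (lebesgue_on I) {s \<in> I. \<bar>a s\<bar> > f t} \<le> ennreal t"
  shows "a \<in> car (symmetrization I X) \<and> nrm (symmetrization I X) a \<le> nrm X f"
proof -
  have re: "rearrangeable I a"
    unfolding rearrangeable_def using level_set_nonempty[OF assms(3) nonneg dom] by blast
  have "\<bar>rearr I a t\<bar> \<le> \<bar>f t\<bar>" if "t \<in> I" for t
    using rearr_le[OF assms(3) nonneg dom, OF that that] rearr_nonneg re that
    by (fastforce simp: rearrangeable_def)
  then have "AE t in lebesgue_on I. \<bar>rearr I a t\<bar> \<le> \<bar>f t\<bar>"
    by (intro AE_I2) simp
  moreover have "rearr I a \<in> L0 I"
    by (intro antimono_on_L0 antimono_on_rearr assms re)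
  ultimately show ?thesis
    using assms(1-3) re unfolding ideal_property_def symmetrization_def by simp
qed

lemma antimono_on_half: "antimono_on I h \<Longrightarrow> antimono_on I (\<lambda>t. h (t / 2))"
  using half_mem by (auto simp: monotone_on_def)

lemma dilation2_antimono:
  assumes "bounded_on (decreasing_cone I X) X dilation2"
  obtains C where "\<And>h. h \<in> car X \<Longrightarrow> antimono_on I h \<Longrightarrow> (\<And>t. t \<in> I \<Longrightarrow> 0 \<le> h t) \<Longrightarrow>
    (\<lambda>t. h (t / 2)) \<in> car X \<and> nrm X (\<lambda>t. h (t / 2)) \<le> ennreal C * nrm X h"
proof -
  obtain C where C: "\<forall>x\<in>decreasing_cone I X. \<exists>y. dilation2 x = Some y \<and> y \<in> car X \<and>
      nrm X y \<le> ennreal C * nrm X x"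
    using assms unfolding bounded_on_def by blast
  show thesis
  proof (rule that)
    fix h assume h: "h \<in> car X" "antimono_on I h" "\<And>t. t \<in> I \<Longrightarrow> 0 \<le> h t"
    then have "h \<in> decreasing_cone I X"
      unfolding decreasing_cone_def by (simp add: antimono_on_rearrangeable AE_rearr_eq)
    with C show "(\<lambda>t. h (t / 2)) \<in> car X \<and> nrm X (\<lambda>t. h (t / 2)) \<le> ennreal C * nrm X h"
      by (fastforce simp: dilation2_def)
  qed
qed

section \<open>The adjoint Hardy operator of order r\<close>

text \<open>Total counterpart of \<open>power_op r (hardy_adj I)\<close>. It takes a default value
  where an integral diverges, so integrability on the tails accompanies it as a separate
  statement.\<close>

definition hardy_adj_pow :: "real \<Rightarrow> (real \<Rightarrow> real) \<Rightarrow> real \<Rightarrow> real" where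
  "hardy_adj_pow r x t = (LINT s:(I \<inter> {t<..})|lebesgue. \<bar>x s\<bar> powr r / s) powr (1 / r)"

lemma hardy_adj_pow_nonneg: "0 \<le> hardy_adj_pow r x t"
  by (simp add: hardy_adj_pow_def)

lemma hardy_adj_pow_bounded:
  assumes "bounded_on (car X) X (power_op r (hardy_adj I))"
  obtains C where "\<And>x. x \<in> car X \<Longrightarrow>
    (\<forall>t\<in>I. set_integrable lebesgue (I \<inter> {t<..}) (\<lambda>s. \<bar>x s\<bar> powr r / s)) \<and>
    hardy_adj_pow r x \<in> car X \<and> nrm X (hardy_adj_pow r x) \<le> ennreal C * nrm X x"
proof -
  obtain C where C: "\<forall>x\<in>car X. \<exists>y. power_op r (hardy_adj I) x = Some y \<and> y \<in> car X \<and>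
      nrm X y \<le> ennreal C * nrm X x"
    using assms unfolding bounded_on_def by blast
  have hardy_adj_pow_eq: "hardy_adj_pow r x = (\<lambda>t. (LINT s:(I \<inter> {t<..})|lebesgue. \<bar>x s\<bar> powr r / s) powr (1 / r))" for x
    by (simp add: hardy_adj_pow_def fun_eq_iff)
  show thesis
    by (rule that[of C]) (use C in \<open>force simp: power_op_def hardy_adj_def hardy_adj_pow_eq split: if_splits\<close>)
qed

lemma hardy_adj_pow_integrand_nonneg: "s \<in> I \<Longrightarrow> 0 \<le> \<bar>x s\<bar> powr r / s"
  using pos[of s] by simp

lemma hardy_adj_pow_integral_nonneg: "t \<in> I \<Longrightarrow> 0 \<le> (LINT s:(I \<inter> {t<..})|lebesgue. \<bar>x s\<bar> powr r / s)"
  unfolding set_lebesgue_integral_def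
  by (intro integral_nonneg_AE AE_I2) (auto simp: indicator_def hardy_adj_pow_integrand_nonneg)

text \<open>The integrand is nonnegative and the domain shrinks as t grows. Integrability matters: a
  divergent integral would count as 0 and break monotonicity.\<close>

lemma antimono_on_adj:
  assumes "r > 0" "\<forall>t\<in>I. set_integrable lebesgue (I \<inter> {t<..}) (\<lambda>s. \<bar>x s\<bar> powr r / s)"
  shows "antimono_on I (hardy_adj_pow r x)"
proof (rule monotone_onI)
  fix s t assume st: "s \<in> I" "t \<in> I" "s \<le> t"
  have "(LINT w:(I \<inter> {t<..})|lebesgue. \<bar>x w\<bar> powr r / w)
      \<le> (LINT w:(I \<inter> {s<..})|lebesgue. \<bar>x w\<bar> powr r / w)"
    unfolding set_lebesgue_integral_def
    by (intro integral_mono) (use assms st in \<open>auto simp: set_integrable_def indicator_def hardy_adj_pow_integrand_nonneg\<close>)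
  then show "hardy_adj_pow r x t \<le> hardy_adj_pow r x s"
    unfolding hardy_adj_pow_def using hardy_adj_pow_integral_nonneg[OF st(2)] assms(1) by (intro powr_mono2) auto
qed

lemma AE_lebesgue_on_iff: "(AE s in lebesgue_on I. P s) \<longleftrightarrow> (AE s in lebesgue. s \<in> I \<longrightarrow> P s)"
  by (subst AE_restrict_space_iff) simp_all

text \<open>Cauchy-Schwarz for p = |x|^(r/2) and q = |y|^(r/2) with weight 1/s on (T/2,T), where pq
  is at least l^(r/2). It is run as 2pq \<le> c p^2 + q^2/c for every c > 0, so that only the
  integrals defining the two operators occur. The point T/2 is used because T may be the right
  endpoint of \<open>I\<close>.\<close>

lemma le_adj_mult_adj:
  assumes r: "0 < r" and lam: "0 < l" and T: "0 < T" "T / 2 \<in> I" "{0<..<T} \<subseteq> I"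
    and v: "AE s in lebesgue_on I. v s = x s * y s" "\<And>s. s \<in> {0<..<T} \<Longrightarrow> l \<le> v s"
    and x: "\<forall>t\<in>I. set_integrable lebesgue (I \<inter> {t<..}) (\<lambda>s. \<bar>x s\<bar> powr r / s)"
    and y: "\<forall>t\<in>I. set_integrable lebesgue (I \<inter> {t<..}) (\<lambda>s. \<bar>y s\<bar> powr r / s)"
  shows "l \<le> 4 powr (1 / r) * (hardy_adj_pow r x (T / 2) * hardy_adj_pow r y (T / 2))"
proof -
  define S where "S = I \<inter> {T / 2<..}"
  define A where "A = (LINT s:S|lebesgue. \<bar>x s\<bar> powr r / s)"
  define B where "B = (LINT s:S|lebesgue. \<bar>y s\<bar> powr r / s)"
  define \<mu> where "\<mu> = l powr (r / 2)"
  have mu: "0 < \<mu>" using lam by (simp add: \<mu>_def)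
  have x': "integrable lebesgue (\<lambda>s. indicator S s *\<^sub>R (\<bar>x s\<bar> powr r / s))"
    and y': "integrable lebesgue (\<lambda>s. indicator S s *\<^sub>R (\<bar>y s\<bar> powr r / s))"
    using x y T(2) by (auto simp: set_integrable_def S_def)
  have AB: "0 \<le> A" "0 \<le> B"
    using hardy_adj_pow_integral_nonneg[OF T(2)] by (simp_all add: A_def B_def S_def)
  have "\<mu> \<le> c * A + B / c" if c: "0 < c" for c
  proof -
    define g where "g s = c * (indicator S s *\<^sub>R (\<bar>x s\<bar> powr r / s))
      + indicator S s *\<^sub>R (\<bar>y s\<bar> powr r / s) / c" for s
    \<comment> \<open>On (T/2,T) the weight satisfies 1/s > 1/T, and 2\<mu>/T times the length T/2
      is exactly \<mu>. On the rest of the tail the bound is just 0.\<close>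
    have "AE s in lebesgue. (2 * \<mu> / T) * indicator {T / 2<..<T} s \<le> g s"
      using v(1)[unfolded AE_lebesgue_on_iff]
    proof (rule AE_mp, intro AE_I2 impI)
      fix s assume *: "s \<in> I \<longrightarrow> v s = x s * y s"
      show "(2 * \<mu> / T) * indicator {T / 2<..<T} s \<le> g s"
      proof (cases "s \<in> {T / 2<..<T}")
        case True
        then have s: "0 < s" "s < T" "s \<in> I" "s \<in> S" using T unfolding S_def by auto
        define p q where "p = \<bar>x s\<bar> powr (r / 2)" "q = \<bar>y s\<bar> powr (r / 2)"
        have pq: "\<bar>x s\<bar> powr r = p\<^sup>2" "\<bar>y s\<bar> powr r = q\<^sup>2"
          by (simp_all add: p_q_def power2_eq_square powr_add[symmetric])
        have "l \<le> \<bar>x s\<bar> * \<bar>y s\<bar>" using v(2)[of s] * s by (auto simp: abs_mult[symmetric])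
        then have "\<mu> \<le> p * q"
          unfolding \<mu>_def p_q_def using lam r
          by (subst powr_mult[symmetric]) (auto intro!: powr_mono2)
        moreover have "0 \<le> (c * p - q)\<^sup>2 / c" using c by simp
        then have "2 * (p * q) \<le> c * p\<^sup>2 + q\<^sup>2 / c"
          using c by (simp add: power2_diff field_simps power2_eq_square)
        ultimately have "2 * \<mu> \<le> c * p\<^sup>2 + q\<^sup>2 / c" by simp
        then have "2 * \<mu> / T \<le> (c * p\<^sup>2 + q\<^sup>2 / c) / s"
          using s mu by (intro frac_le) auto
        then show ?thesis using True s c by (simp add: g_def pq field_simps)
      next
        case False
        moreover have "0 \<le> g s" using c unfolding g_def S_def
          by (intro add_nonneg_nonneg mult_nonneg_nonneg divide_nonneg_nonneg)
            (simp_all add: indicator_def hardy_adj_pow_integrand_nonneg)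
        ultimately show ?thesis by simp
      qed
    qed
    moreover have "integrable lebesgue (\<lambda>s. (2 * \<mu> / T) * indicator {T / 2<..<T} s)"
      by (intro integrable_mult_right integrable_real_indicator) (use T in auto)
    moreover have "integrable lebesgue g"
      unfolding g_def by (intro Bochner_Integration.integrable_add integrable_mult_right
          integrable_divide x' y')
    ultimately have "(LINT s|lebesgue. (2 * \<mu> / T) * indicator {T / 2<..<T} s) \<le> integral\<^sup>L lebesgue g"
      by (intro integral_mono_AE)
    moreover have "(LINT s|lebesgue. (2 * \<mu> / T) * indicator {T / 2<..<T} s) = \<mu>"
      using T(1) by simp
    moreover have "integral\<^sup>L lebesgue g = c * A + B / c"
      unfolding g_def A_def B_def set_lebesgue_integral_def
      by (simp only: Bochner_Integration.integral_add[OF integrable_mult_right[OF x'] integrable_divide[OF y']]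
          integral_mult_right_zero integral_divide_zero)
    ultimately show ?thesis by simp
  qed
  then have "\<mu>\<^sup>2 \<le> 4 * (A * B)"
    using AB mu by (intro le_four_mult_if_AM_GM) auto
  moreover have "\<mu>\<^sup>2 = l powr r"
    by (simp add: \<mu>_def power2_eq_square powr_add[symmetric])
  ultimately have "(l powr r) powr (1 / r) \<le> (4 * (A * B)) powr (1 / r)"
    using r by (intro powr_mono2) auto
  then show ?thesis
    using r lam AB by (simp add: powr_powr powr_mult hardy_adj_pow_def A_def B_def S_def)
qed

section \<open>Factorization of a function from a factorization of its rearrangement\<close>

text \<open>Only the half-line can fail. There v \<ge> l everywhere would follow by monotonicity,
  while \<open>hardy_adj I v\<close> being defined makes v(s)/s integrable on (1,\<infinity>),
  against the divergence of the integral of l/s.\<close>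

lemma bdd_above_superlevel:
  assumes hardy: "bounded_on (car X) X (hardy_adj I)"
    and v: "v \<in> car X" "antimono_on I v" and lam: "0 < l"
  shows "bdd_above {t \<in> I. l \<le> v t}"
proof (rule ccontr)
  assume unbdd: "\<not> ?thesis"
  have "bdd_above {t \<in> {0<..<1}. l \<le> v t}"
    by (rule bdd_aboveI[of _ 1]) auto
  with unbdd interval have I: "I = {0<..}" by metis
  have ge: "l \<le> v s" if "s \<in> I" for s
  proof -
    obtain t where "t \<in> I" "l \<le> v t" "s \<le> t"
      using unbdd bdd_aboveI[of "{t \<in> I. l \<le> v t}" s] by fastforce
    with that show ?thesis using monotone_onD[OF v(2)] by force
  qed
  obtain z where "hardy_adj I v = Some z"
    using hardy v(1) unfolding bounded_on_def by blast
  then have "set_integrable lebesgue {1<..} (\<lambda>s. v s / s)"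
    unfolding hardy_adj_def I by (auto split: if_splits simp: Int_absorb1 dest!: bspec[of _ _ 1])
  then have int: "set_integrable lebesgue {1<..} (\<lambda>s. l * (1 / s))"
  proof (rule set_integrable_bound)
    show "set_borel_measurable lebesgue {1<..} (\<lambda>s. l * (1 / s))"
      unfolding set_borel_measurable_def by (rule measurable_completion) measurable
    show "AE s in lebesgue. s \<in> {1<..} \<longrightarrow> norm (l * (1 / s)) \<le> norm (v s / s)"
      using ge lam by (intro AE_I2) (auto simp: I intro!: divide_right_mono order_trans[OF _ abs_ge_self])
  qed
  then have int: "set_integrable lebesgue {1<..} (\<lambda>s::real. 1 / s)"
    using lam set_integrable_mult_right_iff[of l lebesgue "{1<..}" "\<lambda>s. 1 / s"] by blast
  have "real n \<le> integral {1<..} (\<lambda>s::real. 1 / s)" for n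
  proof -
    have "((\<lambda>s::real. 1 / s) has_integral (ln (exp (real n)) - ln 1)) {1..exp (real n)}"
      by (rule fundamental_theorem_of_calculus)
        (auto intro!: derivative_eq_intros simp: has_real_derivative_iff_has_vector_derivative[symmetric])
    then have *: "((\<lambda>s::real. 1 / s) has_integral (real n)) {1<..<exp (real n)}"
      by (simp add: has_integral_Icc_iff_Ioo)
    show ?thesis
      by (rule has_integral_subset_le[OF _ * integrable_integral])
        (use int in \<open>auto simp: set_lebesgue_integral_eq_integral\<close>)
  qed
  then show False using reals_Archimedean2 not_le by blast
qed

text \<open>\<open>T\<close> is a generalized inverse of \<open>rearr I u\<close>, and a is h(T/2)
  evaluated at the level |u|. On a point where |u| is at most \<open>rearr I u t\<close>, T is at
  least t, so monotonicity gives a \<le> h(t/2), and |b| = |u|/a \<le> k(T/2) \<le> k(t/2). The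
  exceptional points have measure at most t.\<close>

lemma rearr_factorization:
  assumes u: "u \<in> L0 I" "rearrangeable I u"
    and bdd: "\<And>l. 0 < l \<Longrightarrow> bdd_above {t \<in> I. l \<le> rearr I u t}"
    and h: "antimono_on I h" "\<And>t. t \<in> I \<Longrightarrow> 0 \<le> h t"
    and k: "antimono_on I k" "\<And>t. t \<in> I \<Longrightarrow> 0 \<le> k t"
    and est: "\<And>l T. 0 < l \<Longrightarrow> 0 < T \<Longrightarrow> T / 2 \<in> I \<Longrightarrow> {0<..<T} \<subseteq> I \<Longrightarrow>
      (\<And>s. s \<in> {0<..<T} \<Longrightarrow> l \<le> rearr I u s) \<Longrightarrow> l \<le> h (T / 2) * k (T / 2)"
  obtains a b where "a \<in> L0 I" "b \<in> L0 I" "AE s in lebesgue_on I. u s = a s * b s"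
    "\<And>t. t \<in> I \<Longrightarrow> emeasure (lebesgue_on I) {s \<in> I. \<bar>a s\<bar> > h (t / 2)} \<le> ennreal t"
    "\<And>t. t \<in> I \<Longrightarrow> emeasure (lebesgue_on I) {s \<in> I. \<bar>b s\<bar> > k (t / 2)} \<le> ennreal t"
proof -
  have [measurable]: "u \<in> borel_measurable (lebesgue_on I)" using u by (simp add: L0_def)
  note anti = antimono_on_rearr[OF u]
  \<comment> \<open>On \<open>L\<close> the set whose supremum is \<open>T l\<close> is nonempty.
    Off \<open>L\<close> the default G = 0 makes a vanish, and b as well through division by
    zero.\<close>
  define L where "L = {l. 0 < l \<and> (\<exists>t\<in>I. l \<le> rearr I u t)}"
  define T where "T l = Sup {t \<in> I. l \<le> rearr I u t}" for l
  define G where "G l = (if l \<in> L then h (T l / 2) else 0)" for l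
  define a where "a s = G \<bar>u s\<bar>" for s
  define b where "b s = u s / a s" for s
  have T_ge: "t \<le> T l" if "l \<in> L" "t \<in> I" "l \<le> rearr I u t" for l t
    unfolding T_def by (rule cSup_upper) (use that bdd in \<open>auto simp: L_def\<close>)
  have T_le: "T l \<le> M" if "l \<in> L" "\<And>t. t \<in> I \<Longrightarrow> l \<le> rearr I u t \<Longrightarrow> t \<le> M" for l M
    unfolding T_def by (rule cSup_least) (use that in \<open>auto simp: L_def\<close>)
  have T_pos: "0 < T l" if l: "l \<in> L" for l
  proof -
    obtain t where "t \<in> I" "l \<le> rearr I u t" using l by (auto simp: L_def)
    with T_ge[OF l] pos[of t] show ?thesis by force
  qed
  have T_less: "s \<in> I \<and> l \<le> rearr I u s" if l: "l \<in> L" and s: "s \<in> {0<..<T l}" for l s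
  proof -
    \<comment> \<open>The supremum need not be attained, so the lower bound l is available only on
      the open interval (0, T l), which is all that \<open>est\<close> asks for.\<close>
    obtain t where t: "t \<in> I" "l \<le> rearr I u t" "s < t"
      using T_le[OF l, of s] s by force
    then have "s \<in> I" using Ioc_subset[of t] s by auto
    with t monotone_onD[OF anti, of s t] show ?thesis by auto
  qed
  have T_half: "T l / 2 \<in> I" if "l \<in> L" for l
    using T_less[OF that, of "T l / 2"] T_pos[OF that] by auto
  have T_anti: "T l' \<le> T l" if "l \<in> L" "l' \<in> L" "l \<le> l'" for l l'
    using that by (intro T_le T_ge) auto
  have le: "l \<le> h (T l / 2) * k (T l / 2)" if "l \<in> L" for l
    using that T_less[OF that] T_pos[OF that] T_half[OF that]
    by (intro est) (auto simp: L_def)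

  have "mono_on L (\<lambda>l. h (T l / 2))"
  proof (rule monotone_onI)
    fix l l' assume "l \<in> L" "l' \<in> L" "l \<le> l'"
    then show "h (T l / 2) \<le> h (T l' / 2)"
      using T_anti[of l l'] by (intro monotone_onD[OF h(1)] T_half) auto
  qed
  \<comment> \<open>\<open>L\<close> is an interval, and on it G is a decreasing function of the
    decreasing T, hence increasing; this gives Borel measurability of G, and so of a.\<close>
  moreover have "L \<in> sets borel"
    by (rule real_interval_borel_measurable) (force simp: is_interval_1 L_def)
  ultimately have [measurable]: "G \<in> borel_measurable borel"
    unfolding G_def by (subst measurable_restrict_space_iff[symmetric])
      (auto intro: borel_measurable_mono_on_fnc)
  have a: "a \<in> L0 I" unfolding L0_def a_def by measurable
  then have [measurable]: "a \<in> borel_measurable (lebesgue_on I)" by (simp add: L0_def)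
  have b: "b \<in> L0 I" unfolding L0_def b_def by measurable

  \<comment> \<open>|u| may exceed every value of its rearrangement only on a null set, since the
    set where |u| > u^*(t) has measure at most t. The points t = 1/(n+2) lie in both possible
    intervals.\<close>
  have AE_le: "AE s in lebesgue_on I. \<exists>t\<in>I. \<bar>u s\<bar> \<le> rearr I u t"
  proof -
    define B where "B n = {s \<in> I. \<bar>u s\<bar> > rearr I u (1 / real (Suc (Suc n)))}" for n
    have mem: "1 / real (Suc (Suc n)) \<in> I" for n using interval by auto
    have B: "(\<Inter>n. B n) \<in> sets (lebesgue_on I)"
      unfolding B_def using superlevel_sets[OF u(1)] by (intro sets.countable_INT) auto
    have le: "emeasure (lebesgue_on I) (\<Inter>n. B n) \<le> ennreal (1 / real (Suc (Suc n)))" for n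
    proof -
      have "emeasure (lebesgue_on I) (\<Inter>n. B n) \<le> emeasure (lebesgue_on I) (B n)"
        unfolding B_def by (rule emeasure_mono[OF _ superlevel_sets[OF u(1)]]) auto
      also have "\<dots> \<le> ennreal (1 / real (Suc (Suc n)))"
        unfolding B_def
        by (rule emeasure_superlevel_rearr) (use u mem in \<open>auto simp: rearrangeable_def\<close>)
      finally show ?thesis .
    qed
    have "(\<lambda>n. ennreal (1 / real (Suc (Suc n)))) \<longlonglongrightarrow> ennreal 0"
      by (intro tendsto_ennrealI LIMSEQ_Suc lim_1_over_n)
    then have "emeasure (lebesgue_on I) (\<Inter>n. B n) \<le> ennreal 0"
      by (rule LIMSEQ_le_const) (use le in blast)
    with B have "(\<Inter>n. B n) \<in> null_sets (lebesgue_on I)" by auto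
    then have "AE s in lebesgue_on I. s \<notin> (\<Inter>n. B n)" by (rule AE_not_in)
    then show ?thesis
      by (rule AE_mp) (intro AE_I2, use mem in \<open>fastforce simp: B_def not_less\<close>)
  qed
  show thesis
  proof
    show "a \<in> L0 I" "b \<in> L0 I" by fact+
    show "AE s in lebesgue_on I. u s = a s * b s"
      using AE_le
    proof eventually_elim
      case (elim s)
      show ?case
      proof (cases "u s = 0")
        case False
        with elim have "\<bar>u s\<bar> \<in> L" by (simp add: L_def)
        \<comment> \<open>The bound l \<le> h(T/2) k(T/2) with l = |u(s)| > 0 keeps a from
          vanishing, so dividing by it is legitimate.\<close>
        with le[OF this] False have "a s \<noteq> 0" by (auto simp: a_def G_def)
        then show ?thesis by (simp add: b_def)
      qed (simp add: b_def)
    qed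
    show "emeasure (lebesgue_on I) {s \<in> I. \<bar>a s\<bar> > h (t / 2)} \<le> ennreal t" if t: "t \<in> I" for t
    proof -
      have "{s \<in> I. \<bar>a s\<bar> > h (t / 2)} \<subseteq> {s \<in> I. \<bar>u s\<bar> > rearr I u t}"
      proof (rule subsetI, rule ccontr)
        fix s assume s: "s \<in> {s \<in> I. \<bar>a s\<bar> > h (t / 2)}" "s \<notin> {s \<in> I. \<bar>u s\<bar> > rearr I u t}"
        then have "a s \<noteq> 0" using h(2)[OF half_mem[OF t]] by auto
        then have L: "\<bar>u s\<bar> \<in> L" and as: "a s = h (T \<bar>u s\<bar> / 2)"
          by (auto simp: a_def G_def split: if_splits)
        have "a s \<le> h (t / 2)" unfolding as
          using T_ge[OF L t] s by (intro monotone_onD[OF h(1)] T_half half_mem L t) auto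
        then show False using s h(2)[OF T_half[OF L]] as by auto
      qed
      then show ?thesis
        using emeasure_mono[OF _ superlevel_sets[OF u(1)]] emeasure_superlevel_rearr[OF u(1)] u(2) t
        unfolding rearrangeable_def by (meson order_trans)
    qed
    show "emeasure (lebesgue_on I) {s \<in> I. \<bar>b s\<bar> > k (t / 2)} \<le> ennreal t" if t: "t \<in> I" for t
    proof -
      have "{s \<in> I. \<bar>b s\<bar> > k (t / 2)} \<subseteq> {s \<in> I. \<bar>u s\<bar> > rearr I u t}"
      proof (rule subsetI, rule ccontr)
        fix s assume s: "s \<in> {s \<in> I. \<bar>b s\<bar> > k (t / 2)}" "s \<notin> {s \<in> I. \<bar>u s\<bar> > rearr I u t}"
        \<comment> \<open>If a(s) were 0, division by zero would give b(s) = 0, which is not above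
          the nonnegative k(t/2).\<close>
        then have "a s \<noteq> 0" using k(2)[OF half_mem[OF t]] by (auto simp: b_def)
        then have L: "\<bar>u s\<bar> \<in> L" and as: "a s = h (T \<bar>u s\<bar> / 2)"
          by (auto simp: a_def G_def split: if_splits)
        have "0 < a s" using \<open>a s \<noteq> 0\<close> h(2)[OF T_half[OF L]] as by simp
        then have "\<bar>b s\<bar> \<le> k (T \<bar>u s\<bar> / 2)"
          using le[OF L] by (simp add: b_def as field_simps)
        also have "\<dots> \<le> k (t / 2)"
          using T_ge[OF L t] s by (intro monotone_onD[OF k(1)] T_half half_mem L t) auto
        finally show False using s by auto
      qed
      then show ?thesis
        using emeasure_mono[OF _ superlevel_sets[OF u(1)]] emeasure_superlevel_rearr[OF u(1)] u(2) t
        unfolding rearrangeable_def by (meson order_trans)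
    qed
  qed
qed

section \<open>Multipliers between symmetrizations and the product estimate\<close>

text \<open>Where |bz| exceeds g(t/2) z^*(t/2), either |b| exceeds the first factor or |z| the
  second, and each event has measure at most t/2. So the rearrangement of bz is at most the dilation
  of the nonincreasing function g z^*, which lies in \<open>F\<close> because g is a
  multiplier.\<close>

lemma multiplier_symmetrization:
  assumes F: "ideal_property I F"
    and D: "\<And>h. h \<in> car F \<Longrightarrow> antimono_on I h \<Longrightarrow> (\<And>t. t \<in> I \<Longrightarrow> 0 \<le> h t) \<Longrightarrow>
      (\<lambda>t. h (t / 2)) \<in> car F \<and> nrm F (\<lambda>t. h (t / 2)) \<le> ennreal C * nrm F h"
    and g: "g \<in> car (multipliers I E F)" "antimono_on I g" "\<And>t. t \<in> I \<Longrightarrow> 0 \<le> g t"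
    and b: "b \<in> L0 I"
      "\<And>t. t \<in> I \<Longrightarrow> emeasure (lebesgue_on I) {s \<in> I. \<bar>b s\<bar> > g t} \<le> ennreal t"
  shows "b \<in> car (multipliers I (symmetrization I E) (symmetrization I F)) \<and>
    nrm (multipliers I (symmetrization I E) (symmetrization I F)) b
      \<le> ennreal C * nrm (multipliers I E F) g"
proof -
  have *: "(\<lambda>t. b t * z t) \<in> car (symmetrization I F) \<and>
      nrm (symmetrization I F) (\<lambda>t. b t * z t) \<le> ennreal C * nrm F (\<lambda>t. g t * rearr I z t)"
    if z: "z \<in> car (symmetrization I E)" for z
  proof -
    have z': "z \<in> L0 I" "rearrangeable I z" "rearr I z \<in> car E"
      using z by (auto simp: symmetrization_def)
    define w where "w t = g t * rearr I z t" for t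
    have nonneg: "0 \<le> rearr I z t" if "t \<in> I" for t
      using rearr_nonneg z'(2) that by (auto simp: rearrangeable_def)
    have w: "w \<in> car F" "\<And>t. t \<in> I \<Longrightarrow> 0 \<le> w t"
      using g z'(3) nonneg by (auto simp: multipliers_def w_def[abs_def])
    have "antimono_on I w"
      using g nonneg antimono_on_rearr[OF z'(1,2)]
      unfolding monotone_on_def w_def by (auto intro!: mult_mono)
    note Dw = D[OF w(1) this w(2)]
    have bz: "(\<lambda>t. b t * z t) \<in> L0 I"
      using b(1) z'(1) unfolding L0_def by (rule borel_measurable_times)
    have dom: "emeasure (lebesgue_on I) {s \<in> I. \<bar>b s * z s\<bar> > w (t / 2)} \<le> ennreal t"
      if t: "t \<in> I" for t
    proof -
      let ?t = "t / 2"
      let ?B = "{s \<in> I. \<bar>b s\<bar> > g ?t}" and ?Z = "{s \<in> I. \<bar>z s\<bar> > rearr I z ?t}"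
      have t2: "?t \<in> I" by (rule half_mem[OF t])
      have sets: "?B \<in> sets (lebesgue_on I)" "?Z \<in> sets (lebesgue_on I)"
        using superlevel_sets b(1) z'(1) by auto
      have "{s \<in> I. \<bar>b s * z s\<bar> > w ?t} \<subseteq> ?B \<union> ?Z"
      proof (rule subsetI, rule ccontr)
        fix s assume s: "s \<in> {s \<in> I. \<bar>b s * z s\<bar> > w ?t}" "s \<notin> ?B \<union> ?Z"
        then have "\<bar>b s\<bar> * \<bar>z s\<bar> \<le> g ?t * rearr I z ?t"
          using g(3)[OF t2] by (intro mult_mono) auto
        with s show False by (simp add: w_def abs_mult)
      qed
      then have "emeasure (lebesgue_on I) {s \<in> I. \<bar>b s * z s\<bar> > w ?t}
          \<le> emeasure (lebesgue_on I) (?B \<union> ?Z)"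
        using sets by (intro emeasure_mono) auto
      also have "\<dots> \<le> emeasure (lebesgue_on I) ?B + emeasure (lebesgue_on I) ?Z"
        by (rule emeasure_subadditive[OF sets])
      also have "\<dots> \<le> ennreal ?t + ennreal ?t"
        using b(2)[OF t2] emeasure_superlevel_rearr[OF z'(1)] z'(2) t2
        by (intro add_mono) (auto simp: rearrangeable_def)
      also have "\<dots> = ennreal t" using pos[OF t] by (simp flip: ennreal_plus)
      finally show ?thesis .
    qed
    have "(\<lambda>t. b t * z t) \<in> car (symmetrization I F) \<and>
        nrm (symmetrization I F) (\<lambda>t. b t * z t) \<le> nrm F (\<lambda>t. w (t / 2))"
      using Dw w(2) half_mem by (intro symmetrization_dominated[OF F _ bz _ dom]) auto
    with Dw show ?thesis unfolding w_def by (auto intro: order_trans)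
  qed
  have "nrm (symmetrization I F) (\<lambda>t. b t * z t) \<le> ennreal C * nrm (multipliers I E F) g"
    if z: "z \<in> car (symmetrization I E)" "nrm (symmetrization I E) z = 1" for z
  proof -
    \<comment> \<open>The norm of z in the symmetrization is that of \<open>rearr I z\<close> in
      \<open>E\<close>, so \<open>rearr I z\<close> is itself a test function for the multiplier
      norm of g.\<close>
    have "nrm F (\<lambda>t. g t * rearr I z t) \<le> nrm (multipliers I E F) g"
      using z unfolding multipliers_def symmetrization_def by (auto intro!: SUP_upper)
    with * z show ?thesis by (meson mult_left_mono order_trans zero_le)
  qed
  with * b(1) show ?thesis
    by (auto simp: multipliers_def intro!: SUP_least)
qed

text \<open>The multiplier norm tests only elements of norm exactly 1, so x is rescaled to norm 1.
  If x has norm 0, the product vanishes almost everywhere.\<close>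

lemma product_multipliers_le:
  assumes X: "quasi_normed I X" and Y: "quasi_normed I Y"
    and cong: "\<And>v u. v \<in> car Y \<Longrightarrow> u \<in> L0 I \<Longrightarrow> AE t in lebesgue_on I. u t = v t \<Longrightarrow>
      u \<in> car Y \<and> nrm Y u = nrm Y v"
    and u: "u \<in> car (product_space I X (multipliers I X Y))"
  shows "u \<in> car Y \<and> nrm Y u \<le> nrm (product_space I X (multipliers I X Y)) u"
proof -
  let ?M = "multipliers I X Y"
  have uL0: "u \<in> L0 I" using u by (simp add: product_space_def Let_def)
  have *: "u \<in> car Y \<and> nrm Y u \<le> nrm X x * nrm ?M y"
    if xy: "x \<in> car X" "y \<in> car ?M" "AE t in lebesgue_on I. u t = x t * y t" for x y
  proof -
    have yx: "(\<lambda>t. y t * x t) \<in> car Y" using xy by (simp add: multipliers_def)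
    have uY: "u \<in> car Y \<and> nrm Y u = nrm Y (\<lambda>t. y t * x t)"
      using xy(3) by (intro cong[OF yx uL0]) (simp add: mult.commute)
    have "nrm Y (\<lambda>t. y t * x t) \<le> nrm X x * nrm ?M y"
    proof (cases "nrm X x = 0")
      case True
      then have "AE t in lebesgue_on I. x t = 0"
        using X xy(1) unfolding quasi_normed_def quasi_normed_const_def by blast
      then have "AE t in lebesgue_on I. y t * x t = 0" by eventually_elim simp
      then have "nrm Y (\<lambda>t. y t * x t) = 0"
        using Y yx unfolding quasi_normed_def quasi_normed_const_def by blast
      then show ?thesis by simp
    next
      case False
      define c where "c = enn2real (nrm X x)"
      have "nrm X x < \<infinity>"
        using X xy(1) unfolding quasi_normed_def quasi_normed_const_def by blast
      then have c: "nrm X x = ennreal c" "0 < c"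
        using False by (auto simp: c_def enn2real_positive_iff zero_less_iff_neq_zero)
      define z where "z t = (1 / c) * x t" for t
      have z: "z \<in> car X" "nrm X z = ennreal \<bar>1 / c\<bar> * nrm X x"
        using X xy(1) unfolding quasi_normed_def quasi_normed_const_def z_def by blast+
      then have z1: "nrm X z = 1" using c by (simp add: c(1) flip: ennreal_mult)
      have yz: "(\<lambda>t. y t * z t) \<in> car Y" using xy z by (simp add: multipliers_def)
      have "(\<lambda>t. y t * x t) = (\<lambda>t. c * (y t * z t))" using c(2) by (simp add: z_def)
      then have "nrm Y (\<lambda>t. y t * x t) = nrm Y (\<lambda>t. c * (y t * z t))" by (rule arg_cong)
      also have "\<dots> = ennreal \<bar>c\<bar> * nrm Y (\<lambda>t. y t * z t)"
        using Y yz unfolding quasi_normed_def quasi_normed_const_def by auto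
      also have "\<dots> \<le> nrm X x * nrm ?M y"
        using c z(1) z1 unfolding multipliers_def by (auto intro!: mult_left_mono SUP_upper)
      finally show ?thesis .
    qed
    with uY show ?thesis by simp
  qed
  with u show ?thesis unfolding product_space_def Let_def
    by (auto intro!: INF_greatest)
qed

text \<open>Factorizations in \<open>product_space\<close> hold only almost everywhere. Functions
  equal almost everywhere have the same distribution function, hence identical
  rearrangements.\<close>

lemma symmetrization_cong_AE:
  assumes "v \<in> car (symmetrization I X)" "u \<in> L0 I" "AE t in lebesgue_on I. u t = v t"
  shows "u \<in> car (symmetrization I X) \<and> nrm (symmetrization I X) u = nrm (symmetrization I X) v"
proof -
  have v: "v \<in> L0 I" using assms(1) by (simp add: symmetrization_def)
  have "emeasure (lebesgue_on I) {s \<in> I. \<bar>u s\<bar> > l} = emeasure (lebesgue_on I) {s \<in> I. \<bar>v s\<bar> > l}" for l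
    by (rule emeasure_eq_AE[OF _ superlevel_sets[OF assms(2)] superlevel_sets[OF v]])
      (use assms(3) in eventually_elim, simp)
  then have "level_set I u t = level_set I v t" for t by (simp add: level_set_def)
  then have "rearr I u = rearr I v" "rearrangeable I u = rearrangeable I v"
    by (simp_all add: rearr_def rearrangeable_def fun_eq_iff)
  with assms(1,2) show ?thesis by (simp add: symmetrization_def)
qed

end

section \<open>Uniform constants and the equality of spaces\<close>

lemma (in interval_from_zero) factorization_symmetrization:
  assumes E: "normed I E" "ideal_property I E" and F: "ideal_property I F"
    and dil_F: "bounded_on (decreasing_cone I F) F dilation2"
    and hardy_F: "bounded_on (car F) F (hardy_adj I)"
    and dil_E: "bounded_on (decreasing_cone I E) E dilation2"
    and dil_M: "bounded_on (decreasing_cone I (multipliers I E F)) (multipliers I E F) dilation2"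
    and r: "0 < r"
    and adj_E: "bounded_on (car E) E (power_op r (hardy_adj I))"
    and adj_M: "bounded_on (car (multipliers I E F)) (multipliers I E F) (power_op r (hardy_adj I))"
  obtains D where "0 < D"
    "\<And>u x y. u \<in> car (symmetrization I F) \<Longrightarrow> x \<in> car E \<Longrightarrow> y \<in> car (multipliers I E F) \<Longrightarrow>
      AE t in lebesgue_on I. rearr I u t = x t * y t \<Longrightarrow>
      \<exists>a b. a \<in> car (symmetrization I E) \<and>
        b \<in> car (multipliers I (symmetrization I E) (symmetrization I F)) \<and>
        (AE t in lebesgue_on I. u t = a t * b t) \<and>
        nrm (symmetrization I E) a *
          nrm (multipliers I (symmetrization I E) (symmetrization I F)) b
        \<le> ennreal D * (nrm E x * nrm (multipliers I E F) y)"
proof -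
  let ?M = "multipliers I E F" and ?SE = "symmetrization I E"
    and ?SM = "multipliers I (symmetrization I E) (symmetrization I F)"
  obtain CF where CF: "\<And>h. h \<in> car F \<Longrightarrow> antimono_on I h \<Longrightarrow> (\<And>t. t \<in> I \<Longrightarrow> 0 \<le> h t) \<Longrightarrow>
      (\<lambda>t. h (t / 2)) \<in> car F \<and> nrm F (\<lambda>t. h (t / 2)) \<le> ennreal CF * nrm F h"
    by (rule dilation2_antimono[OF dil_F]) blast
  obtain CE where CE: "\<And>h. h \<in> car E \<Longrightarrow> antimono_on I h \<Longrightarrow> (\<And>t. t \<in> I \<Longrightarrow> 0 \<le> h t) \<Longrightarrow>
      (\<lambda>t. h (t / 2)) \<in> car E \<and> nrm E (\<lambda>t. h (t / 2)) \<le> ennreal CE * nrm E h"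
    by (rule dilation2_antimono[OF dil_E]) blast
  obtain CM where CM: "\<And>h. h \<in> car ?M \<Longrightarrow> antimono_on I h \<Longrightarrow> (\<And>t. t \<in> I \<Longrightarrow> 0 \<le> h t) \<Longrightarrow>
      (\<lambda>t. h (t / 2)) \<in> car ?M \<and> nrm ?M (\<lambda>t. h (t / 2)) \<le> ennreal CM * nrm ?M h"
    by (rule dilation2_antimono[OF dil_M]) blast
  obtain HE where HE: "\<And>x. x \<in> car E \<Longrightarrow>
      (\<forall>t\<in>I. set_integrable lebesgue (I \<inter> {t<..}) (\<lambda>s. \<bar>x s\<bar> powr r / s)) \<and>
      hardy_adj_pow r x \<in> car E \<and> nrm E (hardy_adj_pow r x) \<le> ennreal HE * nrm E x"
    by (rule hardy_adj_pow_bounded[OF adj_E]) blast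
  obtain AM where AM: "\<And>x. x \<in> car ?M \<Longrightarrow>
      (\<forall>t\<in>I. set_integrable lebesgue (I \<inter> {t<..}) (\<lambda>s. \<bar>x s\<bar> powr r / s)) \<and>
      hardy_adj_pow r x \<in> car ?M \<and> nrm ?M (hardy_adj_pow r x) \<le> ennreal AM * nrm ?M x"
    by (rule hardy_adj_pow_bounded[OF adj_M]) blast
  define K :: real where "K = 4 powr (1 / r)"
  have K: "0 \<le> K" by (simp add: K_def)
  \<comment> \<open>D1 collects the dilation on \<open>E\<close>, the factor 4^(1/r) placed entirely
    in h, and the operator bound on \<open>E\<close>. D2 contains two dilations: the one on
    multipliers for k(t/2), the one on \<open>F\<close> for the products bz. The maxima with 0 allow
    for negative constants in \<open>bounded_on\<close>, which \<open>ennreal\<close> turns into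
    0.\<close>
  define D1 where "D1 = max 0 CE * (K * max 0 HE)"
  define D2 where "D2 = max 0 CF * (max 0 CM * max 0 AM)"
  have D12: "0 \<le> D1" "0 \<le> D2" using K by (simp_all add: D1_def D2_def)
  have max0: "ennreal c = ennreal (max 0 c)" for c by (simp add: max_def ennreal_neg)
  show thesis
  \<comment> \<open>The summand 1 keeps the constant positive, so that it can be divided out in the
    passage to the infimum.\<close>
  proof (rule that[of "D1 * D2 + 1"])
    show "0 < D1 * D2 + 1" using D12 by (simp add: add_nonneg_pos)
  next
    fix u x y
    assume u: "u \<in> car (symmetrization I F)" and x: "x \<in> car E" and y: "y \<in> car ?M"
      and uxy: "AE t in lebesgue_on I. rearr I u t = x t * y t"
    have u': "u \<in> L0 I" "rearrangeable I u" "rearr I u \<in> car F"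
      using u by (auto simp: symmetrization_def)
    note AEx = HE[OF x] and AMy = AM[OF y]
    define h where "h t = K * hardy_adj_pow r x t" for t
    define k where "k = hardy_adj_pow r y"
    have anti_x: "antimono_on I (hardy_adj_pow r x)" by (intro antimono_on_adj r) (use AEx in blast)
    have h: "antimono_on I h" "\<And>t. t \<in> I \<Longrightarrow> 0 \<le> h t"
      using anti_x K unfolding h_def monotone_on_def by (auto intro: mult_left_mono simp: hardy_adj_pow_nonneg)
    have k: "antimono_on I k" "\<And>t. t \<in> I \<Longrightarrow> 0 \<le> k t"
      unfolding k_def by (intro antimono_on_adj r) (use AMy in blast, rule hardy_adj_pow_nonneg)
    have hE: "h \<in> car E" "nrm E h = ennreal K * nrm E (hardy_adj_pow r x)"
    proof -
      have "(\<lambda>t. K * hardy_adj_pow r x t) \<in> car E \<and> nrm E (\<lambda>t. K * hardy_adj_pow r x t) = ennreal \<bar>K\<bar> * nrm E (hardy_adj_pow r x)"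
        using E(1) AEx unfolding normed_def quasi_normed_const_def by blast
      then show "h \<in> car E" "nrm E h = ennreal K * nrm E (hardy_adj_pow r x)"
        using K by (simp_all add: h_def[abs_def])
    qed
    have kM: "k \<in> car ?M" using AMy by (simp add: k_def)
    have bdd: "bdd_above {t \<in> I. l \<le> rearr I u t}" if "0 < l" for l
      by (rule bdd_above_superlevel[OF hardy_F u'(3) antimono_on_rearr[OF u'(1,2)] that])
    have est: "l \<le> h (T / 2) * k (T / 2)"
      if "0 < l" "0 < T" "T / 2 \<in> I" "{0<..<T} \<subseteq> I" "\<And>s. s \<in> {0<..<T} \<Longrightarrow> l \<le> rearr I u s" for l T
      using le_adj_mult_adj[OF r that(1-4) uxy that(5)] AEx AMy
      by (simp add: h_def k_def K_def mult.assoc)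
    obtain a b where ab: "a \<in> L0 I" "b \<in> L0 I" "AE s in lebesgue_on I. u s = a s * b s"
      "\<And>t. t \<in> I \<Longrightarrow> emeasure (lebesgue_on I) {s \<in> I. \<bar>a s\<bar> > h (t / 2)} \<le> ennreal t"
      "\<And>t. t \<in> I \<Longrightarrow> emeasure (lebesgue_on I) {s \<in> I. \<bar>b s\<bar> > k (t / 2)} \<le> ennreal t"
      using rearr_factorization[OF u'(1,2) bdd h k est] by blast
    note CEh = CE[OF hE(1) h] and CMk = CM[OF kM k]
    have "a \<in> car ?SE \<and> nrm ?SE a \<le> nrm E (\<lambda>t. h (t / 2))"
      using CEh ab h half_mem by (intro symmetrization_dominated E(2)) auto
    moreover have "nrm E (\<lambda>t. h (t / 2)) \<le> ennreal D1 * nrm E x"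
    proof -
      have "nrm E (\<lambda>t. h (t / 2)) \<le> ennreal CE * (ennreal K * nrm E (hardy_adj_pow r x))"
        using CEh hE(2) by simp
      also have "\<dots> \<le> ennreal CE * (ennreal K * (ennreal HE * nrm E x))"
        using AEx by (intro mult_left_mono) auto
      also have "\<dots> = ennreal D1 * nrm E x"
        using K by (simp add: D1_def max0[of CE] max0[of HE] ennreal_mult mult.assoc)
      finally show ?thesis .
    qed
    ultimately have a: "a \<in> car ?SE" "nrm ?SE a \<le> ennreal D1 * nrm E x" by auto
    \<comment> \<open>Here g is k(t/2), a multiplier by the dilation bound, so forming bz brings in
      a second dilation.\<close>
    have "b \<in> car ?SM \<and> nrm ?SM b \<le> ennreal CF * nrm ?M (\<lambda>t. k (t / 2))"
      using CMk k half_mem ab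
      by (intro multiplier_symmetrization[OF F CF] antimono_on_half) auto
    moreover have "ennreal CF * nrm ?M (\<lambda>t. k (t / 2)) \<le> ennreal D2 * nrm ?M y"
    proof -
      have "ennreal CF * nrm ?M (\<lambda>t. k (t / 2)) \<le> ennreal CF * (ennreal CM * nrm ?M k)"
        using CMk by (intro mult_left_mono) auto
      also have "\<dots> \<le> ennreal CF * (ennreal CM * (ennreal AM * nrm ?M y))"
        using AMy by (intro mult_left_mono) (auto simp: k_def)
      also have "\<dots> = ennreal D2 * nrm ?M y"
        by (simp add: D2_def max0[of CF] max0[of CM] max0[of AM] ennreal_mult mult.assoc)
      finally show ?thesis .
    qed
    ultimately have b: "b \<in> car ?SM" "nrm ?SM b \<le> ennreal D2 * nrm ?M y" by auto
    have "nrm ?SE a * nrm ?SM b \<le> (ennreal D1 * nrm E x) * (ennreal D2 * nrm ?M y)"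
      by (intro mult_mono a b) auto
    also have "\<dots> = ennreal (D1 * D2) * (nrm E x * nrm ?M y)"
      using D12 by (simp add: ennreal_mult ac_simps)
    also have "\<dots> \<le> ennreal (D1 * D2 + 1) * (nrm E x * nrm ?M y)"
      by (intro mult_right_mono ennreal_leI) auto
    finally show "\<exists>a b. a \<in> car ?SE \<and> b \<in> car ?SM \<and> (AE t in lebesgue_on I. u t = a t * b t) \<and>
        nrm ?SE a * nrm ?SM b \<le> ennreal (D1 * D2 + 1) * (nrm E x * nrm ?M y)"
      using a b ab(3) by blast
  qed
qed

theorem corollary3:
  fixes I :: "real set" and E F :: fspace and r r1 :: real
  assumes "I = {0<..<1} \<or> I = {0<..}"
    and "banach_ideal_space I E" and "banach_ideal_space I F"
    and "fatou_property I F"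
    and "nonzero_space I (symmetrization I E)" and "normable I (symmetrization I E)"
    and "nonzero_space I (symmetrization I F)" and "normable I (symmetrization I F)"
    and "bounded_on (decreasing_cone I F) F dilation2"
    and "nonzero_space I (symmetrization I (koethe_dual I F))"
    and "nonzero_space I
           (symmetrization I (koethe_dual I (product_space I E (koethe_dual I F))))"
    \<comment> \<open>(i)\<close>
    and "bounded_on (car F) F (hardy_adj I)"
    and "bounded_on (car (product_space I E (koethe_dual I F)))
           (product_space I E (koethe_dual I F)) (hardy_adj I)"
    \<comment> \<open>(ii)\<close>
    and "r > 0"
    and "bounded_on (car E) E (power_op r (hardy_adj I))"
    and "bounded_on (car (koethe_dual I F)) (koethe_dual I F) (power_op r (hardy_adj I))"
    and "bounded_on (rearr I ` car (symmetrization I E)) E (power_op r (hardy I))"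
    and "bounded_on (rearr I ` car (symmetrization I (koethe_dual I F))) (koethe_dual I F)
           (power_op r (hardy I))"
    \<comment> \<open>(iii)\<close>
    and "nonzero_space I (symmetrization I (multipliers I E F))"
    and "bounded_on (decreasing_cone I E) E dilation2"
    and "bounded_on (decreasing_cone I (multipliers I E F)) (multipliers I E F) dilation2"
    and "r1 > 0"
    and "bounded_on (car E) E (power_op r1 (hardy_adj I))"
    and "bounded_on (car (multipliers I E F)) (multipliers I E F) (power_op r1 (hardy_adj I))"
    \<comment> \<open>\<open>F\<close> factorizes through \<open>E\<close>\<close>
    and "same_space F (product_space I E (multipliers I E F))"
  shows "same_space (symmetrization I F)
           (product_space I (symmetrization I E)
              (multipliers I (symmetrization I E) (symmetrization I F)))"
proof -
  interpret interval_from_zero I by unfold_locales fact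
  let ?M = "multipliers I E F" and ?SE = "symmetrization I E" and ?SF = "symmetrization I F"
  let ?SM = "multipliers I ?SE ?SF"
  let ?P = "product_space I ?SE ?SM"
  have ban: "normed I E" "ideal_property I E" "ideal_property I F"
    using assms(2,3) by (auto simp: banach_ideal_space_def)
  obtain D where D: "0 < D"
    "\<And>u x y. u \<in> car ?SF \<Longrightarrow> x \<in> car E \<Longrightarrow> y \<in> car ?M \<Longrightarrow>
      AE t in lebesgue_on I. rearr I u t = x t * y t \<Longrightarrow>
      \<exists>a b. a \<in> car ?SE \<and> b \<in> car ?SM \<and> (AE t in lebesgue_on I. u t = a t * b t) \<and>
        nrm ?SE a * nrm ?SM b \<le> ennreal D * (nrm E x * nrm ?M y)"
    using factorization_symmetrization[OF ban assms(9,12,20,21,22,23,24)] by blast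
  obtain C where C: "car F = car (product_space I E ?M)"
    "\<And>v. v \<in> car F \<Longrightarrow> nrm (product_space I E ?M) v \<le> ennreal C * nrm F v"
    using assms(25) unfolding same_space_def by blast
  have qn: "quasi_normed I ?SE" "quasi_normed I ?SF"
    using assms(6,8) by (auto simp: normable_def)
  \<comment> \<open>The converse inclusion holds with constant 1; normability supplies the
    quasi-norms whose homogeneity it rests on.\<close>
  have sub: "u \<in> car ?SF \<and> nrm ?SF u \<le> nrm ?P u" if "u \<in> car ?P" for u
    using qn symmetrization_cong_AE that by (rule product_multipliers_le)
  have sup: "u \<in> car ?P \<and> nrm ?P u \<le> ennreal (D * max 0 C) * nrm ?SF u" if u: "u \<in> car ?SF" for u
  proof -
    have u': "u \<in> L0 I" "rearr I u \<in> car F" using u by (auto simp: symmetrization_def)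
    let ?Q = "\<lambda>X Y v. {(x, y). x \<in> car X \<and> y \<in> car Y \<and> (AE t in lebesgue_on I. v t = x t * y t)}"
    have ex: "\<exists>(a, b)\<in>?Q ?SE ?SM u. nrm ?SE a * nrm ?SM b \<le> ennreal D * (nrm E x * nrm ?M y)"
      if "(x, y) \<in> ?Q E ?M (rearr I u)" for x y
      using D(2)[OF u, of x y] that by auto
    have "?Q E ?M (rearr I u) \<noteq> {}"
      using u'(2) unfolding C(1) product_space_def Let_def by simp
    then have "?Q ?SE ?SM u \<noteq> {}" using ex by fast
    then have "u \<in> car ?P" using u'(1) by (simp add: product_space_def Let_def)
    moreover have "nrm ?P u \<le> ennreal D * nrm (product_space I E ?M) (rearr I u)"
    proof -
      have "nrm ?P u \<le> ennreal D * (case p of (x, y) \<Rightarrow> nrm E x * nrm ?M y)"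
        if p: "p \<in> ?Q E ?M (rearr I u)" for p
      proof -
        obtain x y where xy: "p = (x, y)" by (cases p)
        obtain a b where ab: "(a, b) \<in> ?Q ?SE ?SM u"
          "nrm ?SE a * nrm ?SM b \<le> ennreal D * (nrm E x * nrm ?M y)"
          using ex[OF p[unfolded xy]] by blast
        have "nrm ?P u \<le> nrm ?SE a * nrm ?SM b"
          unfolding product_space_def Let_def by (simp, rule INF_lower2[OF ab(1)], simp)
        with ab(2) xy show ?thesis by (simp add: order_trans)
      qed
      \<comment> \<open>The left side does not depend on the factorization of
        \<open>rearr I u\<close>, and \<open>D\<close> is the same for all of them.\<close>
      then have "nrm ?P u \<le> ennreal D * (INF p\<in>?Q E ?M (rearr I u). case p of (x, y) \<Rightarrow> nrm E x * nrm ?M y)"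
        by (rule le_mult_INF_ennreal[OF D(1)])
      then show ?thesis by (simp add: product_space_def)
    qed
    moreover have "\<dots> \<le> ennreal D * (ennreal C * nrm F (rearr I u))"
      by (intro mult_left_mono C(2) u'(2)) simp
    moreover have "\<dots> = ennreal (D * max 0 C) * nrm ?SF u"
      using D(1) by (simp add: symmetrization_def ennreal_mult mult.assoc max_def ennreal_neg)
    ultimately show ?thesis by (metis order_trans)
  qed
  show ?thesis
    unfolding same_space_def
  proof (intro conjI exI[of _ "max 1 (D * max 0 C)"] ballI)
    show "car ?SF = car ?P" using sub sup by blast
    fix u assume u: "u \<in> car ?SF"
    have "nrm ?SF u \<le> 1 * nrm ?P u" using sub sup u by simp
    also have "\<dots> \<le> ennreal (max 1 (D * max 0 C)) * nrm ?P u"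
      by (intro mult_right_mono) (auto simp flip: ennreal_1 intro: ennreal_leI)
    finally show "nrm ?SF u \<le> ennreal (max 1 (D * max 0 C)) * nrm ?P u" .
    have "nrm ?P u \<le> ennreal (D * max 0 C) * nrm ?SF u" using sup u by blast
    also have "\<dots> \<le> ennreal (max 1 (D * max 0 C)) * nrm ?SF u"
      by (intro mult_right_mono ennreal_leI) auto
    finally show "nrm ?P u \<le> ennreal (max 1 (D * max 0 C)) * nrm ?SF u" .
  qed
qed

end
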